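(* Place $n$ chips on the vertex $v_0$ of the Sierpinski gasket graph $SG_m$ (with $m$ large enough depending on $n$, and no chips elsewhere) and stabilize. Let $r_n$ be the radius of the set $S_n$ of vertices that at some point contain a chip during the stabilization. Then, as $n\to\infty$, $$r_n=\Theta\left(n^{1/D_f}\right),\qquad D_f=\frac{\log 3}{\log 2}.$$
   Context: Graphs. $SG_0$ is a triangle (complete graph on 3 vertices, all of them called corners: left, right, top). For $m\ge 1$, $SG_m$ is obtained from three copies of $SG_{m-1}$ (bottom-left, bottom-right, top) by identifying, for each pair of copies, one corner of one with one corner of the other in the usual Sierpinski gasket arrangement: right corner of bottom-left with left corner of bottom-right, top corner of bottom-left with left corner of top, top corner of bottom-right with right corner of top. The remaining three unidentified corners are the corners of $SG_m$. Every vertex of $SG_m$ other than its three corners has degree 4. The vertex $v_0$ of $SG_m$ is the vertex shared by the two bottom copies of $SG_{m-1}$. Sandpile dynamics. A configuration assigns a nonnegative integer number of chips to each vertex. A vertex $v$ with at least $\deg(v)$ chips is unstable and may topple, sending one chip to each neighbour. Topple unstable vertices until all are stable; the final configuration and the number of topplings $u(v)$ of each vertex (the odometer) do not depend on the order. Setup. For a positive integer $n$, start with $n$ chips on $v_0$ and $0$ chips on all other vertices of $SG_m$, where $m$ is taken large enough (depending on $n$) that during stabilization chips stay in the bottom two level $m-1$ copies and never reach the top copy or the corners of $SG_m$; in particular the boundary/sink of $SG_m$ plays no role and the sets below do not depend on the choice of such $m$. $d$ is the graph metric. $T_n=\{v: u(v)\ge 1\}$ is the set of vertices that topple, and $S_n$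 is the set of vertices that contain a chip at some point of the process (for $n\ge4$, $S_n=T_n\cup\partial T_n$, where $\partial T_n$ is the set of vertices adjacent to those in $T_n$). The radius $r_n$ is $\max_{v\in S_n} d(v_0,v)$. *)

theory Defs
  imports Complex_Main "HOL-Library.Landau_Symbols"
begin

section \<open>Sierpinski gasket graphs\<close>

text \<open>
  The pair \<open>(a, b)\<close> stands for the point \<open>a e + b f\<close> of the triangular lattice, where \<open>e\<close> is the
  horizontal unit vector and \<open>f\<close> the unit vector at angle 60 degrees. The left, right and top
  corners of the level \<open>m\<close> graph are \<open>(0, 0)\<close>, \<open>(2 ^ m, 0)\<close> and \<open>(0, 2 ^ m)\<close>. The corners of the
  three copies that have to be identified have the same coordinates, so gluing is set union.
\<close>

type_synonym point = "nat \<times> nat"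

definition shift :: "point \<Rightarrow> point \<Rightarrow> point" where
  "shift p v = (fst v + fst p, snd v + snd p)"

definition sg_corners :: "nat \<Rightarrow> point set" where
  "sg_corners m = {(0, 0), (2 ^ m, 0), (0, 2 ^ m)}"

fun sg_verts :: "nat \<Rightarrow> point set" where
  "sg_verts 0 = sg_corners 0"
| "sg_verts (Suc m) =
     sg_verts m \<union> shift (2 ^ m, 0) ` sg_verts m \<union> shift (0, 2 ^ m) ` sg_verts m"

text \<open>Edge sets are symmetric sets of ordered pairs.\<close>

fun sg_edges :: "nat \<Rightarrow> (point \<times> point) set" where
  "sg_edges 0 = {(v, w). v \<in> sg_verts 0 \<and> w \<in> sg_verts 0 \<and> v \<noteq> w}"
| "sg_edges (Suc m) =
     sg_edges m
     \<union> map_prod (shift (2 ^ m, 0)) (shift (2 ^ m, 0)) ` sg_edges m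
     \<union> map_prod (shift (0, 2 ^ m)) (shift (0, 2 ^ m)) ` sg_edges m"

text \<open>The following two definitions are meaningful for \<open>m \<ge> 1\<close>.\<close>

definition sg_top_copy :: "nat \<Rightarrow> point set" where
  "sg_top_copy m = shift (0, 2 ^ (m - 1)) ` sg_verts (m - 1)"

definition sg_origin :: "nat \<Rightarrow> point" where
  "sg_origin m = (2 ^ (m - 1), 0)"

text \<open>No vertices other than the prescribed corners are identified.\<close>

lemma sg_verts_le: "v \<in> sg_verts m \<Longrightarrow> fst v + snd v \<le> 2 ^ m"
  by (induction m arbitrary: v) (auto simp: sg_corners_def shift_def, fastforce+)

lemma sg_corners_subset: "sg_corners m \<subseteq> sg_verts m"
proof (induction m)
  case (Suc m)
  have "(2 ^ Suc m, 0) = shift (2 ^ m, 0) (2 ^ m, 0)" "(0, 2 ^ Suc m) = shift (0, 2 ^ m) (0, 2 ^ m)"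
    by (simp_all add: shift_def)
  with Suc show ?case by (auto simp: sg_corners_def)
qed simp

lemma sg_copies_inter:
  "sg_verts m \<inter> shift (2 ^ m, 0) ` sg_verts m = {(2 ^ m, 0)}"
  "sg_verts m \<inter> shift (0, 2 ^ m) ` sg_verts m = {(0, 2 ^ m)}"
  "shift (2 ^ m, 0) ` sg_verts m \<inter> shift (0, 2 ^ m) ` sg_verts m = {(2 ^ m, 2 ^ m)}"
proof -
  have c: "(0, 0) \<in> sg_verts m" "(2 ^ m, 0) \<in> sg_verts m" "(0, 2 ^ m) \<in> sg_verts m"
    using sg_corners_subset[of m] by (auto simp: sg_corners_def)
  have s: "(2 ^ m, 0) = shift (2 ^ m, 0) (0, 0)" "(0, 2 ^ m) = shift (0, 2 ^ m) (0, 0)"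
    "(2 ^ m, 2 ^ m) = shift (2 ^ m, 0) (0, 2 ^ m)" "(2 ^ m, 2 ^ m) = shift (0, 2 ^ m) (2 ^ m, 0)"
    by (simp_all add: shift_def)
  show "sg_verts m \<inter> shift (2 ^ m, 0) ` sg_verts m = {(2 ^ m, 0)}"
  proof (intro equalityI)
    show "{(2 ^ m, 0)} \<subseteq> sg_verts m \<inter> shift (2 ^ m, 0) ` sg_verts m"
      using c s(1) by blast
  qed (force dest!: sg_verts_le simp: shift_def)
  show "sg_verts m \<inter> shift (0, 2 ^ m) ` sg_verts m = {(0, 2 ^ m)}"
  proof (intro equalityI)
    show "{(0, 2 ^ m)} \<subseteq> sg_verts m \<inter> shift (0, 2 ^ m) ` sg_verts m"
      using c s(2) by blast
  qed (force dest!: sg_verts_le simp: shift_def)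
  show "shift (2 ^ m, 0) ` sg_verts m \<inter> shift (0, 2 ^ m) ` sg_verts m = {(2 ^ m, 2 ^ m)}"
  proof (intro equalityI)
    show "{(2 ^ m, 2 ^ m)} \<subseteq> shift (2 ^ m, 0) ` sg_verts m \<inter> shift (0, 2 ^ m) ` sg_verts m"
      using c s(3,4) by blast
  qed (force dest!: sg_verts_le simp: shift_def)
qed


section \<open>Sandpile dynamics on a graph\<close>

definition degree :: "('v \<times> 'v) set \<Rightarrow> 'v \<Rightarrow> nat" where
  "degree E v = card (E `` {v})"

definition graph_dist :: "('v \<times> 'v) set \<Rightarrow> 'v \<Rightarrow> 'v \<Rightarrow> nat" where
  "graph_dist E v w = (LEAST k. (v, w) \<in> E ^^ k)"

definition topple :: "('v \<times> 'v) set \<Rightarrow> 'v \<Rightarrow> ('v \<Rightarrow> nat) \<Rightarrow> 'v \<Rightarrow> nat" where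
  "topple E v c = (\<lambda>w. if w = v then c w - degree E v
                       else if (v, w) \<in> E then c w + 1
                       else c w)"

fun legal :: "'v set \<Rightarrow> ('v \<times> 'v) set \<Rightarrow> ('v \<Rightarrow> nat) \<Rightarrow> 'v list \<Rightarrow> bool" where
  "legal V E c [] \<longleftrightarrow> True"
| "legal V E c (v # vs) \<longleftrightarrow> v \<in> V \<and> degree E v \<le> c v \<and> legal V E (topple E v c) vs"

definition stable :: "'v set \<Rightarrow> ('v \<times> 'v) set \<Rightarrow> ('v \<Rightarrow> nat) \<Rightarrow> bool" where
  "stable V E c \<longleftrightarrow> (\<forall>v\<in>V. c v < degree E v)"

definition stabilizing :: "'v set \<Rightarrow> ('v \<times> 'v) set \<Rightarrow> ('v \<Rightarrow> nat) \<Rightarrow> 'v list \<Rightarrow> bool" where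
  "stabilizing V E c vs \<longleftrightarrow> legal V E c vs \<and> stable V E (fold (topple E) vs c)"

definition occupied :: "'v set \<Rightarrow> ('v \<times> 'v) set \<Rightarrow> ('v \<Rightarrow> nat) \<Rightarrow> 'v list \<Rightarrow> 'v set" where
  "occupied V E c vs = {v \<in> V. \<exists>k \<le> length vs. fold (topple E) (take k vs) c v \<ge> 1}"


section \<open>The single-source sandpile on the gasket\<close>

definition sg_initial :: "nat \<Rightarrow> nat \<Rightarrow> point \<Rightarrow> nat" where
  "sg_initial m n = (\<lambda>v. if v = sg_origin m then n else 0)"

definition sg_stabilizing :: "nat \<Rightarrow> nat \<Rightarrow> point list \<Rightarrow> bool" where
  "sg_stabilizing m n vs \<longleftrightarrow> stabilizing (sg_verts m) (sg_edges m) (sg_initial m n) vs"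

text \<open>
  The set of occupied vertices and the radius take the toppling sequence as an argument, so that
  results can be stated for every order of topplings.
\<close>

definition sg_occupied :: "nat \<Rightarrow> nat \<Rightarrow> point list \<Rightarrow> point set" where
  "sg_occupied m n vs = occupied (sg_verts m) (sg_edges m) (sg_initial m n) vs"

definition sg_radius :: "nat \<Rightarrow> nat \<Rightarrow> point list \<Rightarrow> nat" where
  "sg_radius m n vs = Max (graph_dist (sg_edges m) (sg_origin m) ` sg_occupied m n vs)"

text \<open>
  The level \<open>m\<close> suffices for \<open>n\<close> chips: the process stabilizes and no chip ever lies on a vertex of
  the top copy or on a corner. All vertices of the graph, corners included, may topple in
  \<^const>\<open>legal\<close>; there is no sink, which makes no difference under this condition.
\<close>

definition sg_large_enough :: "nat \<Rightarrow> nat \<Rightarrow> bool" where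
  "sg_large_enough m n \<longleftrightarrow>
     m \<ge> 1 \<and> (\<exists>vs. sg_stabilizing m n vs) \<and>
     (\<forall>vs. sg_stabilizing m n vs \<longrightarrow>
        sg_occupied m n vs \<inter> (sg_top_copy m \<union> sg_corners m) = {})"

end

theory Submission
  imports Defs
begin

text \<open>
  By the least action principle the odometer lies below every nonnegative integer function \<open>f\<close> for
  which the initial configuration plus the Laplacian of \<open>f\<close> is stable. On each of the two level
  \<open>k\<close> triangles meeting at \<open>v\<^sub>0\<close> there is an explicit such \<open>f\<close>: the function with Laplacian 2 in the
  interior, value \<open>5 ^ k\<close> at \<open>v\<^sub>0\<close> and value 0 at the two other corners. It is integral, it sends a
  single chip through each of these two corners, and it absorbs \<open>2 * 3 ^ (k + 1) - 2\<close> chips at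
  \<open>v\<^sub>0\<close>. So about \<open>3 ^ k\<close> chips stay within distance of order \<open>2 ^ k\<close>. Conversely, a stable
  configuration has at most three chips per vertex, and a ball of radius \<open>2 ^ k\<close> around \<open>v\<^sub>0\<close> has
  only order \<open>3 ^ k\<close> vertices.
\<close>

section \<open>The least action principle\<close>

locale sandpile_graph =
  fixes V :: "'v set" and E :: "('v \<times> 'v) set"
  assumes finite_V: "finite V"
    and edges_in: "E \<subseteq> V \<times> V"
    and sym_E: "sym E"
    and irrefl_E: "irrefl E"
begin

lemma finite_nbrs: "finite (E `` {v})"
  using finite_V edges_in by (auto intro: finite_subset[of _ V])

text \<open>Legality makes the natural-number subtraction in \<open>topple\<close> exact. Symmetry
  of \<open>E\<close> allows the gain at \<open>w\<close> to be read off the neighbours of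
  \<open>w\<close>, ready for summation over them.\<close>

lemma int_topple:
  assumes "degree E v \<le> c v"
  shows "int (topple E v c w) =
    int (c w) + (if v \<in> E `` {w} then 1 else 0) - (if v = w then int (degree E w) else 0)"
  using assms sym_E irrefl_E by (auto simp: topple_def sym_def irrefl_def of_nat_diff)

text \<open>A neighbour sends one chip to \<open>v\<close> per toppling, and \<open>v\<close> loses
  one chip per neighbour, so the net change is the Laplacian of the odometer at
  \<open>v\<close>.\<close>

lemma int_fold_topple:
  assumes "legal V E c vs"
  shows "int (fold (topple E) vs c v) =
    int (c v) + (\<Sum>w\<in>E `` {v}. int (count_list vs w) - int (count_list vs v))"
  using assms
proof (induction vs arbitrary: c)
  case (Cons x vs)
  have "(\<Sum>w\<in>E `` {v}. int (count_list (x # vs) w) - int (count_list (x # vs) v)) =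
    (\<Sum>w\<in>E `` {v}. int (count_list vs w) - int (count_list vs v)) +
    (\<Sum>w\<in>E `` {v}. if x = w then 1 else 0) - (\<Sum>w\<in>E `` {v}. if x = v then 1 else 0)"
    unfolding sum.distrib[symmetric] sum_subtractf[symmetric] by (intro sum.cong) auto
  then show ?case
    using Cons finite_nbrs[of v] by (simp add: int_topple sum.delta degree_def)
qed simp

lemma legal_snoc:
  "legal V E c (vs @ [v]) \<longleftrightarrow>
     legal V E c vs \<and> v \<in> V \<and> degree E v \<le> fold (topple E) vs c v"
  by (induction vs arbitrary: c) auto

text \<open>Consider the first toppling, say at \<open>x\<close>, that would push the count above
  \<open>f\<close>. Just before it the count equals \<open>f\<close> at \<open>x\<close> and is at
  most \<open>f\<close> elsewhere, so its Laplacian at \<open>x\<close> is at most that of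
  \<open>f\<close>. Then \<open>x\<close> holds fewer than \<open>degree E x\<close> chips and the
  toppling is illegal. The sequence need not be complete.\<close>

lemma least_action:
  assumes "legal V E c vs"
    and nonneg: "\<And>v. 0 \<le> f v"
    and stabilizes: "\<And>v. v \<in> V \<Longrightarrow> int (c v) + (\<Sum>w\<in>E `` {v}. f w - f v) < int (degree E v)"
  shows "int (count_list vs v) \<le> f v"
  using assms(1)
proof (induction vs arbitrary: v rule: rev_induct)
  case Nil
  then show ?case using nonneg by simp
next
  case (snoc x vs)
  have legal: "legal V E c vs" and x: "x \<in> V" "degree E x \<le> fold (topple E) vs c x"
    using snoc.prems by (auto simp: legal_snoc)
  have IH: "int (count_list vs w) \<le> f w" for w
    using snoc.IH[OF legal] .
  have "int (count_list vs x) \<noteq> f x"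
  proof
    assume eq: "int (count_list vs x) = f x"
    have "(\<Sum>w\<in>E `` {x}. int (count_list vs w) - int (count_list vs x)) \<le> (\<Sum>w\<in>E `` {x}. f w - f x)"
      using IH eq by (intro sum_mono) simp
    then show False
      using stabilizes[OF x(1)] x(2) int_fold_topple[OF legal, of x] by linarith
  qed
  then show ?case
    using IH[of v] IH[of x] by (cases "x = v") auto
qed

lemma legal_in_V: "legal V E c vs \<Longrightarrow> set vs \<subseteq> V"
  by (induction vs arbitrary: c) auto

text \<open>By least action no legal sequence is longer than the total of \<open>f\<close>. A
  longest legal sequence ends in a stable configuration, since an unstable vertex would extend
  it.\<close>

lemma stabilizing_exists:
  assumes nonneg: "\<And>v. 0 \<le> f v"
    and stabilizes: "\<And>v. v \<in> V \<Longrightarrow> int (c v) + (\<Sum>w\<in>E `` {v}. f w - f v) < int (degree E v)"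
  shows "\<exists>vs. stabilizing V E c vs"
proof -
  have bound: "length vs \<le> nat (\<Sum>v\<in>V. f v)" if "legal V E c vs" for vs
  proof -
    have "(\<Sum>v\<in>V. count_list vs v) = length vs"
      using legal_in_V[OF that] finite_V by (rule sum_count_set)
    then have "int (length vs) = (\<Sum>v\<in>V. int (count_list vs v))"
      by (simp flip: of_nat_sum)
    also have "\<dots> \<le> (\<Sum>v\<in>V. f v)"
      using least_action[OF that nonneg stabilizes] by (intro sum_mono)
    finally show ?thesis by simp
  qed
  obtain vs where vs: "legal V E c vs" "\<And>ws. legal V E c ws \<Longrightarrow> length ws \<le> length vs"
    using ex_has_greatest_nat[of "legal V E c" "[]" length] bound
    by (metis le_imp_less_Suc legal.simps(1))
  have "stable V E (fold (topple E) vs c)"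
  proof (rule ccontr)
    assume "\<not> ?thesis"
    then obtain v where "v \<in> V" "degree E v \<le> fold (topple E) vs c v"
      by (auto simp: stable_def not_less)
    then have "legal V E c (vs @ [v])"
      using vs(1) by (simp add: legal_snoc)
    from vs(2)[OF this] show False by simp
  qed
  with vs(1) show ?thesis by (auto simp: stabilizing_def)
qed

text \<open>Chips move only along edges out of toppling vertices; this passes from a bound on
  toppled vertices to a bound on occupied ones.\<close>

lemma occupied_origin:
  assumes "v \<in> occupied V E c vs"
  shows "1 \<le> c v \<or> (\<exists>w\<in>set vs. (w, v) \<in> E)"
proof -
  have "1 \<le> fold (topple E) ws c v \<Longrightarrow> 1 \<le> c v \<or> (\<exists>w\<in>set ws. (w, v) \<in> E)" for ws
  proof (induction ws arbitrary: c)
    case (Cons x ws)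
    then have "1 \<le> topple E x c v \<or> (\<exists>w\<in>set ws. (w, v) \<in> E)" by simp
    then show ?case by (auto simp: topple_def split: if_splits)
  qed simp
  then show ?thesis
    using assms by (auto simp: occupied_def dest: in_set_takeD)
qed

lemma sum_fold_topple:
  assumes "legal V E c vs"
  shows "(\<Sum>v\<in>V. fold (topple E) vs c v) = (\<Sum>v\<in>V. c v)"
  using assms
proof (induction vs arbitrary: c)
  case (Cons x vs)
  then have x: "x \<in> V" "degree E x \<le> c x" by auto
  \<comment> \<open>By symmetry of \<open>E\<close>, the vertices that gain a chip from
    \<open>x\<close> are exactly its neighbours, so gains and losses balance.\<close>
  have card: "(\<Sum>w\<in>V. if x \<in> E `` {w} then 1 else 0) = int (degree E x)"
  proof -
    have "{w\<in>V. x \<in> E `` {w}} = E `` {x}"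
      using edges_in sym_E by (auto simp: sym_def)
    then show ?thesis
      using finite_V by (simp add: degree_def sum.If_cases Int_def)
  qed
  have "int (\<Sum>v\<in>V. topple E x c v) = int (\<Sum>v\<in>V. c v)"
    unfolding of_nat_sum int_topple[where c = c, OF x(2)] sum.distrib sum_subtractf card
    using finite_V x(1) by (simp add: sum.delta)
  then have "(\<Sum>v\<in>V. topple E x c v) = (\<Sum>v\<in>V. c v)"
    by (rule of_nat_eq_iff[THEN iffD1])
  then show ?case using Cons by simp
qed simp

text \<open>Chips are conserved, they all end on occupied vertices, and stability leaves at most
  \<open>d\<close> on each.\<close>

lemma sum_le_card_occupied:
  assumes "stabilizing V E c vs" and "\<And>v. v \<in> V \<Longrightarrow> degree E v \<le> Suc d"
  shows "(\<Sum>v\<in>V. c v) \<le> d * card (occupied V E c vs)"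
proof -
  let ?c = "fold (topple E) vs c"
  have legal: "legal V E c vs" and stable: "stable V E ?c"
    using assms(1) by (auto simp: stabilizing_def)
  have "(\<Sum>v\<in>V. c v) = (\<Sum>v\<in>V. ?c v)"
    using sum_fold_topple[OF legal] by simp
  also have "\<dots> = (\<Sum>v\<in>occupied V E c vs. ?c v)"
  proof (rule sum.mono_neutral_right)
    show "\<forall>v\<in>V - occupied V E c vs. ?c v = 0"
      by (auto simp: occupied_def dest: spec[of _ "length vs"])
  qed (use finite_V in \<open>auto simp: occupied_def\<close>)
  also have "\<dots> \<le> (\<Sum>v\<in>occupied V E c vs. d)"
  proof (rule sum_mono)
    fix v assume "v \<in> occupied V E c vs"
    then have "v \<in> V" by (simp add: occupied_def)
    then show "?c v \<le> d" using stable assms(2)[of v] by (force simp: stable_def)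
  qed
  finally show ?thesis by (simp add: mult.commute)
qed

end


section \<open>The gasket graph\<close>

lemma finite_sg_verts: "finite (sg_verts m)"
  by (induction m) (auto simp: sg_corners_def)

lemma card_sg_verts: "card (sg_verts m) \<le> 3 ^ Suc m"
proof (induction m)
  case (Suc m)
  have "card (sg_verts (Suc m)) \<le>
    card (sg_verts m) + card (shift (2 ^ m, 0) ` sg_verts m) + card (shift (0, 2 ^ m) ` sg_verts m)"
    by (simp add: card_Un_le order_trans[OF card_Un_le])
  also have "\<dots> \<le> 3 * card (sg_verts m)"
    using card_image_le[OF finite_sg_verts, of "shift (2 ^ m, 0)" m]
      card_image_le[OF finite_sg_verts, of "shift (0, 2 ^ m)" m] by linarith
  finally show ?case using Suc by simp
qed (simp add: sg_corners_def)

lemma sg_edges_in: "sg_edges m \<subseteq> sg_verts m \<times> sg_verts m"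
  by (induction m) auto

lemma sym_sg_edges: "sym (sg_edges m)"
proof (induction m)
  case (Suc m)
  have "sym (map_prod f f ` R)" if "sym R" for f :: "point \<Rightarrow> point" and R
    using that by (intro symI) (elim imageE, metis map_prod_simp prod.exhaust_sel prod.inject image_eqI symD)
  with Suc show ?case by (simp add: sym_Un)
qed (auto simp: sym_def)

lemma irrefl_sg_edges: "irrefl (sg_edges m)"
proof (induction m)
  case (Suc m)
  then show ?case by (auto simp: irrefl_def shift_def)
qed (auto simp: irrefl_def)

section \<open>Lattice steps and paths from the corners\<close>

interpretation sg: sandpile_graph "sg_verts m" "sg_edges m"
  by unfold_locales (simp_all add: finite_sg_verts sg_edges_in sym_sg_edges irrefl_sg_edges)

text \<open>Edges are unit steps of the triangular lattice. The bounds are one-sided; applying them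
  to the reversed edge gives the other side.\<close>

lemma sg_edges_lipschitz:
  "(v, w) \<in> sg_edges m \<Longrightarrow>
     fst w \<le> fst v + 1 \<and> snd w \<le> snd v + 1 \<and> fst w + snd w \<le> fst v + snd v + 1"
proof (induction m arbitrary: v w)
  case (Suc m)
  then consider "(v, w) \<in> sg_edges m"
    | p x y where "v = shift p x" "w = shift p y" "(x, y) \<in> sg_edges m" by auto
  then show ?case
  proof cases
    case 2
    with Suc.IH[OF 2(3)] show ?thesis by (auto simp: shift_def)
  qed (rule Suc.IH)
qed (auto simp: sg_corners_def)

text \<open>Lower bounds for distances: to the left of \<open>v0\<close> the first coordinate
  measures progress, to the right the sum of both coordinates does.\<close>

lemma sg_path_lipschitz:
  "(v, w) \<in> sg_edges m ^^ j \<Longrightarrow>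
     fst w \<le> fst v + j \<and> fst v \<le> fst w + j \<and> fst w + snd w \<le> fst v + snd v + j"
proof (induction j arbitrary: w)
  case (Suc j)
  then obtain x where x: "(v, x) \<in> sg_edges m ^^ j" "(x, w) \<in> sg_edges m" by auto
  then have "(w, x) \<in> sg_edges m" using sym_sg_edges by (auto dest: symD)
  from sg_edges_lipschitz[OF this] sg_edges_lipschitz[OF x(2)] Suc.IH[OF x(1)]
  show ?case by linarith
qed auto

lemma sg_path_Suc:
  assumes "(v, w) \<in> sg_edges m ^^ j"
  shows "(v, w) \<in> sg_edges (Suc m) ^^ j"
    "(shift (2 ^ m, 0) v, shift (2 ^ m, 0) w) \<in> sg_edges (Suc m) ^^ j"
    "(shift (0, 2 ^ m) v, shift (0, 2 ^ m) w) \<in> sg_edges (Suc m) ^^ j"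
proof -
  have path_map: "(f v, f w) \<in> sg_edges (Suc m) ^^ j"
    if "\<And>x y. (x, y) \<in> sg_edges m \<Longrightarrow> (f x, f y) \<in> sg_edges (Suc m)" for f
    using assms by (induction j arbitrary: w) (auto intro: that simp del: sg_edges.simps)
  show "(v, w) \<in> sg_edges (Suc m) ^^ j"
    "(shift (2 ^ m, 0) v, shift (2 ^ m, 0) w) \<in> sg_edges (Suc m) ^^ j"
    "(shift (0, 2 ^ m) v, shift (0, 2 ^ m) w) \<in> sg_edges (Suc m) ^^ j"
    by (rule path_map[of "\<lambda>x. x"] path_map; force)+
qed

lemma path_trans: "(x, y) \<in> R ^^ i \<Longrightarrow> (y, z) \<in> R ^^ j \<Longrightarrow> (x, z) \<in> R ^^ (i + j)"
  by (auto simp: relpow_add)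

lemma sg_corners_in: "(0, 0) \<in> sg_verts m" "(2 ^ m, 0) \<in> sg_verts m" "(0, 2 ^ m) \<in> sg_verts m"
  using sg_corners_subset[of m] by (auto simp: sg_corners_def)

lemma sg_path_from_left:
  \<comment> \<open>A path to a vertex of another copy goes first to the left corner of that copy,
    at cost \<open>2 ^ m\<close>, and then continues inside it.\<close>
  "v \<in> sg_verts m \<Longrightarrow> ((0, 0), v) \<in> sg_edges m ^^ (fst v + snd v)"
proof (induction m arbitrary: v)
  case 0
  then show ?case by (auto simp: sg_corners_def)
next
  case (Suc m)
  have "((0, 0), (2 ^ m, 0)) \<in> sg_edges (Suc m) ^^ (2 ^ m)"
    and "((0, 0), (0, 2 ^ m)) \<in> sg_edges (Suc m) ^^ (2 ^ m)"
    using sg_path_Suc(1)[OF Suc.IH[OF sg_corners_in(2)]] sg_path_Suc(1)[OF Suc.IH[OF sg_corners_in(3)]]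
    by simp_all
  note corner_paths = this[THEN path_trans]
  from Suc.prems consider "v \<in> sg_verts m"
    | w where "v = shift (2 ^ m, 0) w" "w \<in> sg_verts m"
    | w where "v = shift (0, 2 ^ m) w" "w \<in> sg_verts m" by auto
  then show ?case
  proof cases
    case 1
    then show ?thesis by (intro sg_path_Suc(1) Suc.IH)
  next
    case 2
    with corner_paths(1)[of v "fst w + snd w"] sg_path_Suc(2)[OF Suc.IH[OF 2(2)]]
    show ?thesis by (simp add: shift_def ac_simps)
  next
    case 3
    with corner_paths(2)[of v "fst w + snd w"] sg_path_Suc(3)[OF Suc.IH[OF 3(2)]]
    show ?thesis by (simp add: shift_def ac_simps)
  qed
qed

text \<open>The mirror image: the right corners of the left and top copies are
  \<open>(2 ^ m, 0)\<close> and \<open>(2 ^ m, 2 ^ m)\<close>, and both are \<open>2 ^ m\<close>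
  steps away from the right corner of the whole.\<close>

lemma sg_path_from_right:
  "v \<in> sg_verts m \<Longrightarrow> ((2 ^ m, 0), v) \<in> sg_edges m ^^ (2 ^ m - fst v)"
proof (induction m arbitrary: v)
  case 0
  then show ?case by (auto simp: sg_corners_def)
next
  case (Suc m)
  have "((2 ^ Suc m, 0), (2 ^ m, 0)) \<in> sg_edges (Suc m) ^^ (2 ^ m)"
    and "((2 ^ Suc m, 0), (2 ^ m, 2 ^ m)) \<in> sg_edges (Suc m) ^^ (2 ^ m)"
    using sg_path_Suc(2)[OF Suc.IH[OF sg_corners_in(1)]] sg_path_Suc(2)[OF Suc.IH[OF sg_corners_in(3)]]
    by (simp_all add: shift_def mult_2)
  note corner_paths = this[THEN path_trans]
  from Suc.prems consider "v \<in> sg_verts m"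
    | w where "v = shift (2 ^ m, 0) w" "w \<in> sg_verts m"
    | w where "v = shift (0, 2 ^ m) w" "w \<in> sg_verts m" by auto
  then show ?case
  proof cases
    case 1
    have "2 ^ m + (2 ^ m - fst v) = 2 ^ Suc m - fst v"
      using sg_verts_le[OF 1] by simp
    with corner_paths(1)[of v "2 ^ m - fst v"] sg_path_Suc(1)[OF Suc.IH[OF 1]]
    show ?thesis by simp
  next
    case 2
    with sg_path_Suc(2)[OF Suc.IH[OF 2(2)]]
    show ?thesis by (simp add: shift_def mult_2)
  next
    case 3
    have "2 ^ m + (2 ^ m - fst v) = 2 ^ Suc m - fst v"
      using sg_verts_le[OF 3(2)] 3(1) by (simp add: shift_def)
    with 3 corner_paths(2)[of v "2 ^ m - fst v"] sg_path_Suc(3)[OF Suc.IH[OF 3(2)]]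
    show ?thesis by (simp add: shift_def)
  qed
qed

section \<open>Counting vertices near a corner\<close>

lemma card_sg_left_part: "card {v \<in> sg_verts m. fst v + snd v < 2 ^ k} \<le> 3 ^ Suc k"
proof (induction m)
  case 0
  have "card {v \<in> sg_verts 0. fst v + snd v < 2 ^ k} \<le> card (sg_verts 0)"
    by (intro card_mono finite_sg_verts) auto
  also have "\<dots> \<le> 3 ^ Suc k" using card_sg_verts[of 0] by (simp add: order_trans)
  finally show ?case .
next
  case (Suc m)
  show ?case
  \<comment> \<open>For \<open>k \<le> m\<close> the strict inequality confines the set to the left
    copy, so it does not grow with the level. Otherwise the whole graph is small enough.\<close>
  proof (cases "k \<le> m")
    case True
    then have "(2::nat) ^ k \<le> 2 ^ m" by simp
    then have "{v \<in> sg_verts (Suc m). fst v + snd v < 2 ^ k} \<subseteq> {v \<in> sg_verts m. fst v + snd v < 2 ^ k}"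
      by (auto simp: shift_def simp del: power_increasing_iff)
    then have "card {v \<in> sg_verts (Suc m). fst v + snd v < 2 ^ k} \<le> card {v \<in> sg_verts m. fst v + snd v < 2 ^ k}"
      by (intro card_mono) (auto simp: finite_sg_verts)
    with Suc show ?thesis by linarith
  next
    case False
    have "card {v \<in> sg_verts (Suc m). fst v + snd v < 2 ^ k} \<le> card (sg_verts (Suc m))"
      by (intro card_mono finite_sg_verts) auto
    also have "\<dots> \<le> 3 ^ Suc (Suc m)" by (rule card_sg_verts)
    also have "\<dots> \<le> 3 ^ Suc k" using False by (intro power_increasing) auto
    finally show ?thesis .
  qed
qed

lemma card_sg_right_part: "card {v \<in> sg_verts m. 2 ^ m < fst v + 2 ^ k} \<le> 3 ^ Suc k"
proof (induction m)
  case 0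
  have "card {v \<in> sg_verts 0. 2 ^ 0 < fst v + 2 ^ k} \<le> card (sg_verts 0)"
    by (intro card_mono finite_sg_verts) auto
  also have "\<dots> \<le> 3 ^ Suc k" using card_sg_verts[of 0] by (simp add: order_trans)
  finally show ?case .
next
  case (Suc m)
  show ?case
  \<comment> \<open>For \<open>k \<le> m\<close> the inequality forces \<open>2 ^ m < fst v\<close>,
    which holds only in the right copy.\<close>
  proof (cases "k \<le> m")
    case True
    then have "(2::nat) ^ k \<le> 2 ^ m" by simp
    then have "{v \<in> sg_verts (Suc m). 2 ^ Suc m < fst v + 2 ^ k} \<subseteq>
        shift (2 ^ m, 0) ` {v \<in> sg_verts m. 2 ^ m < fst v + 2 ^ k}"
      by (auto simp del: power_increasing_iff simp: shift_def dest: sg_verts_le)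
    then have "card {v \<in> sg_verts (Suc m). 2 ^ Suc m < fst v + 2 ^ k} \<le>
        card {v \<in> sg_verts m. 2 ^ m < fst v + 2 ^ k}"
      by (rule surj_card_le[rotated]) (auto simp: finite_sg_verts)
    with Suc show ?thesis by linarith
  next
    case False
    have "card {v \<in> sg_verts (Suc m). 2 ^ Suc m < fst v + 2 ^ k} \<le> card (sg_verts (Suc m))"
      by (intro card_mono finite_sg_verts) auto
    also have "\<dots> \<le> 3 ^ Suc (Suc m)" by (rule card_sg_verts)
    also have "\<dots> \<le> 3 ^ Suc k" using False by (intro power_increasing) auto
    finally show ?thesis .
  qed
qed


section \<open>Gluing functions on the three copies\<close>

text \<open>Separates the vertices lying in exactly one copy from the three glued corners, where two
  copies contribute. The side conditions make the contributions of the other copies vanish.\<close>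

lemma sg_Suc_cases [consumes 1, case_names left right top left_right left_top right_top]:
  assumes "(a, b) \<in> sg_verts (Suc m)"
  obtains "(a, b) \<in> sg_verts m" "a < 2 ^ m" "b < 2 ^ m"
    | a' where "a = 2 ^ m + a'" "(a', b) \<in> sg_verts m" "0 < a' + b" "b < 2 ^ m" "(a, b) \<notin> sg_verts m"
    | b' where "b = 2 ^ m + b'" "(a, b') \<in> sg_verts m" "0 < a + b'" "a < 2 ^ m" "(a, b) \<notin> sg_verts m"
    | "a = 2 ^ m" "b = 0" | "a = 0" "b = 2 ^ m" | "a = 2 ^ m" "b = 2 ^ m"
proof -
  from assms consider "(a, b) \<in> sg_verts m"
    | a' where "a = 2 ^ m + a'" "(a', b) \<in> sg_verts m"
    | b' where "b = 2 ^ m + b'" "(a, b') \<in> sg_verts m"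
    by (auto simp: shift_def add.commute)
  then show ?thesis
  proof cases
    case 1
    with sg_verts_le[OF 1] show ?thesis
      by (cases "a < 2 ^ m"; cases "b < 2 ^ m") (auto intro: that)
  next
    case 2
    with sg_verts_le[OF 2(2)] sg_verts_le[of "(a, b)" m] show ?thesis
      by (cases "a' + b = 0"; cases "b < 2 ^ m") (auto intro: that(2,4,6))
  next
    case 3
    with sg_verts_le[OF 3(2)] sg_verts_le[of "(a, b)" m] show ?thesis
      by (cases "a + b' = 0"; cases "a < 2 ^ m") (auto intro: that(3,5,6))
  qed
qed

lemma sg_nbrs_in: "w \<in> sg_edges m `` {v} \<Longrightarrow> v \<in> sg_verts m \<and> w \<in> sg_verts m"
  using sg_edges_in by auto

lemma sg_nbrs_outside: "v \<notin> sg_verts m \<Longrightarrow> sg_edges m `` {v} = {}"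
  using sg_edges_in by auto

lemma Image_map_prod: "(map_prod f f ` R) `` {z} = {f y |x y. (x, y) \<in> R \<and> z = f x}"
  by force

lemma Image_map_prod_shift:
  "(map_prod (shift p) (shift p) ` R) `` {(a, b)} =
     (if fst p \<le> a \<and> snd p \<le> b then shift p ` (R `` {(a - fst p, b - snd p)}) else {})"
proof -
  have "(a, b) = shift p x \<longleftrightarrow> fst p \<le> a \<and> snd p \<le> b \<and> x = (a - fst p, b - snd p)" for x
    by (auto simp: shift_def prod_eq_iff)
  then have "(map_prod (shift p) (shift p) ` R) `` {(a, b)} =
    {shift p y |y. ((a - fst p, b - snd p), y) \<in> R \<and> fst p \<le> a \<and> snd p \<le> b}"
    unfolding Image_map_prod by simp
  then show ?thesis by (simp add: Image_singleton image_Collect)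
qed

text \<open>Degrees and Laplacians both reduce to the three copies through this identity. The guards
  protect against truncated subtraction; a copy not containing \<open>(a, b)\<close> contributes an
  empty sum.\<close>

lemma sum_sg_nbrs_Suc:
  fixes F :: "point \<Rightarrow> 'a :: comm_monoid_add"
  shows "(\<Sum>w\<in>sg_edges (Suc m) `` {(a, b)}. F w) =
    (\<Sum>w\<in>sg_edges m `` {(a, b)}. F w) +
    (if 2 ^ m \<le> a then \<Sum>w\<in>sg_edges m `` {(a - 2 ^ m, b)}. F (shift (2 ^ m, 0) w) else 0) +
    (if 2 ^ m \<le> b then \<Sum>w\<in>sg_edges m `` {(a, b - 2 ^ m)}. F (shift (0, 2 ^ m) w) else 0)"
proof -
  let ?r = "shift (2 ^ m, 0)" and ?t = "shift (0, 2 ^ m)"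
  define L where "L = sg_edges m `` {(a, b)}"
  define R where "R = (if 2 ^ m \<le> a then ?r ` (sg_edges m `` {(a - 2 ^ m, b)}) else {})"
  define T where "T = (if 2 ^ m \<le> b then ?t ` (sg_edges m `` {(a, b - 2 ^ m)}) else {})"
  have inj: "inj_on (shift p) A" for p A
    by (auto simp: inj_on_def shift_def prod_eq_iff)
  have fin: "finite L" "finite R" "finite T"
    using sg.finite_nbrs by (simp_all add: L_def R_def T_def)
  have nbrs: "sg_edges (Suc m) `` {(a, b)} = L \<union> R \<union> T"
    by (simp add: Un_Image Image_map_prod_shift L_def R_def T_def)
  have L_in: "{(a, b), w} \<subseteq> sg_verts m" if "w \<in> L" for w
    using sg_nbrs_in[OF that[unfolded L_def]] by simp
  have R_in: "{(a, b), w} \<subseteq> ?r ` sg_verts m" if "w \<in> R" for w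
  proof -
    from that obtain y where y: "y \<in> sg_edges m `` {(a - 2 ^ m, b)}" "w = ?r y" and "2 ^ m \<le> a"
      by (auto simp only: R_def image_iff split: if_splits)
    then have "(a, b) = ?r (a - 2 ^ m, b)" by (simp add: shift_def)
    then show ?thesis using sg_nbrs_in[OF y(1)] y(2) by (metis bot_least imageI insert_subset)
  qed
  have T_in: "{(a, b), w} \<subseteq> ?t ` sg_verts m" if "w \<in> T" for w
  proof -
    from that obtain y where y: "y \<in> sg_edges m `` {(a, b - 2 ^ m)}" "w = ?t y" and "2 ^ m \<le> b"
      by (auto simp only: T_def image_iff split: if_splits)
    then have "(a, b) = ?t (a, b - 2 ^ m)" by (simp add: shift_def)
    then show ?thesis using sg_nbrs_in[OF y(1)] y(2) by (metis bot_least imageI insert_subset)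
  qed
  have loop: "(a, b) \<notin> L \<union> R \<union> T"
    using irrefl_sg_edges[of "Suc m"] unfolding nbrs[symmetric] irrefl_def Image_singleton_iff by (rule spec)
  \<comment> \<open>A neighbour shared by two copies would lie, together with \<open>(a, b)\<close>
    itself, in their one-point intersection, giving a loop.\<close>
  have no_common: "A \<inter> B = {}"
    if "\<And>w. w \<in> A \<Longrightarrow> {(a, b), w} \<subseteq> S" "\<And>w. w \<in> B \<Longrightarrow> {(a, b), w} \<subseteq> S'"
      "S \<inter> S' = {x}" "(a, b) \<notin> A" for A B S S' and x :: point
  proof (rule ccontr)
    assume "A \<inter> B \<noteq> {}"
    then obtain w where w: "w \<in> A" "w \<in> B" by auto
    then have "{(a, b), w} \<subseteq> {x}" using that(1,2)[of w] that(3) by auto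
    with w that(4) show False by auto
  qed
  have "L \<inter> R = {}"
    by (rule no_common[OF L_in R_in sg_copies_inter(1)]) (use loop in simp_all)
  moreover have "L \<inter> T = {}"
    by (rule no_common[OF L_in T_in sg_copies_inter(2)]) (use loop in simp_all)
  moreover have "R \<inter> T = {}"
    by (rule no_common[OF R_in T_in sg_copies_inter(3)]) (use loop in simp_all)
  ultimately have "(L \<union> R) \<inter> T = {}" "L \<inter> R = {}" by auto
  then have "(\<Sum>w\<in>sg_edges (Suc m) `` {(a, b)}. F w) = sum F L + sum F R + sum F T"
    unfolding nbrs using fin by (simp add: sum.union_disjoint)
  then show ?thesis
    using inj by (simp add: L_def R_def T_def sum.reindex)
qed

lemma sg_degree:
  "v \<in> sg_verts m \<Longrightarrow> degree (sg_edges m) v = (if v \<in> sg_corners m then 2 else 4)"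
proof (induction m arbitrary: v)
  case 0
  have "sg_edges 0 `` {(0, 0)} = {(1, 0), (0, 1)}" "sg_edges 0 `` {(1, 0)} = {(0, 0), (0, 1)}"
    "sg_edges 0 `` {(0, 1)} = {(0, 0), (1, 0)}"
    by (simp_all add: sg_corners_def Image_singleton) blast+
  moreover from 0 have "v = (0, 0) \<or> v = (1, 0) \<or> v = (0, 1)"
    by (simp add: sg_corners_def)
  ultimately show ?case
    by (elim disjE) (simp_all add: degree_def sg_corners_def del: sg_edges.simps)
next
  case (Suc m)
  obtain a b where v: "v = (a, b)" by (cases v)
  have outside: "degree (sg_edges m) w = 0" if "w \<notin> sg_verts m" for w
    using that by (simp add: degree_def sg_nbrs_outside)
  define N :: nat where "N = 2 ^ m"
  have N: "2 ^ m = N" "0 < N" by (simp_all add: N_def)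
  have corners: "sg_corners m = {(0, 0), (N, 0), (0, N)}"
    "sg_corners (Suc m) = {(0, 0), (2 * N, 0), (0, 2 * N)}"
    by (simp_all add: sg_corners_def N_def)
  have corner_degree: "degree (sg_edges m) (0, 0) = 2" "degree (sg_edges m) (N, 0) = 2"
    "degree (sg_edges m) (0, N) = 2"
    using Suc.IH sg_corners_in[of m] by (auto simp: corners N)
  \<comment> \<open>Degrees add over the copies: a glued corner gets 2 + 2.\<close>
  have "degree (sg_edges (Suc m)) (a, b) = degree (sg_edges m) (a, b) +
    (if N \<le> a then degree (sg_edges m) (a - N, b) else 0) +
    (if N \<le> b then degree (sg_edges m) (a, b - N) else 0)"
    using sum_sg_nbrs_Suc[of "\<lambda>_. 1 :: nat" m a b]
    by (simp add: degree_def N del: sg_edges.simps)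
  also from Suc.prems[unfolded v]
  have "\<dots> =
    (if (a, b) \<in> sg_corners (Suc m) then 2 else 4)"
  proof (cases rule: sg_Suc_cases[where m = m, unfolded N, consumes 1, case_names left right top left_right left_top right_top])
    case left
    then show ?thesis
      using Suc.IH[OF left(1)] by (simp add: corners)
  next
    case (right a')
    then show ?thesis
      using Suc.IH[OF right(2)] outside[OF right(5)] by (auto simp: corners)
  next
    case (top b')
    then show ?thesis
      using Suc.IH[OF top(2)] outside[OF top(5)] by (auto simp: corners)
  next
    case right_top
    moreover have "(N, N) \<notin> sg_verts m" using sg_verts_le[of "(N, N)" m] N by auto
    ultimately show ?thesis using corner_degree outside N(2) by (simp add: corners)
  qed (use N(2) corner_degree in \<open>simp_all add: corners\<close>)
  finally show ?case unfolding v .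
qed

text \<open>With this sign it is the net gain of chips at \<open>v\<close> when every vertex
  \<open>w\<close> topples \<open>f w\<close> times.\<close>

definition laplacian :: "nat \<Rightarrow> (point \<Rightarrow> int) \<Rightarrow> point \<Rightarrow> int" where
  "laplacian m f v = (\<Sum>w\<in>sg_edges m `` {v}. f w - f v)"

lemma laplacian_outside: "v \<notin> sg_verts m \<Longrightarrow> laplacian m f v = 0"
  by (simp add: laplacian_def sg_nbrs_outside)

lemma laplacian_zero: "laplacian m (\<lambda>_. 0) v = 0"
  by (simp add: laplacian_def)

text \<open>Copies are recognised by coordinates alone. A shared corner takes its value from the
  first applicable copy in the order left, right, top, and the default 0 keeps supports
  bounded.\<close>

definition glue ::
  "nat \<Rightarrow> (point \<Rightarrow> int) \<Rightarrow> (point \<Rightarrow> int) \<Rightarrow> (point \<Rightarrow> int) \<Rightarrow> point \<Rightarrow> int" where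
  "glue m l r t = (\<lambda>(a, b).
     if a + b \<le> 2 ^ m then l (a, b)
     else if 2 ^ m \<le> a then r (a - 2 ^ m, b)
     else if 2 ^ m \<le> b then t (a, b - 2 ^ m)
     else 0)"

context
  fixes m :: nat and l r t :: "point \<Rightarrow> int"
  assumes left_right: "l (2 ^ m, 0) = r (0, 0)"
    and left_top: "l (0, 2 ^ m) = t (0, 0)"
    and right_top: "r (0, 2 ^ m) = t (2 ^ m, 0)"
begin

lemma glue_on_copies:
  assumes "v \<in> sg_verts m"
  shows "glue m l r t v = l v"
    "glue m l r t (shift (2 ^ m, 0) v) = r v"
    "glue m l r t (shift (0, 2 ^ m) v) = t v"
proof -
  obtain a b where v: "v = (a, b)" by (cases v)
  have le: "a + b \<le> 2 ^ m" using sg_verts_le[OF assms] v by simp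
  show "glue m l r t v = l v" using le by (simp add: glue_def v)
  show "glue m l r t (shift (2 ^ m, 0) v) = r v"
    using left_right by (auto simp: glue_def v shift_def)
  show "glue m l r t (shift (0, 2 ^ m) v) = t v"
  \<comment> \<open>The right corner of the top copy is evaluated through \<open>r\<close>, so it
    needs the compatibility of \<open>r\<close> and \<open>t\<close>.\<close>
  proof (cases "a = 2 ^ m")
    case True
    then have "b = 0" using le by simp
    then show ?thesis using True right_top by (simp add: glue_def v shift_def)
  next
    case False
    then show ?thesis using left_top le by (auto simp: glue_def v shift_def)
  qed
qed

text \<open>Every edge lies in one copy, where \<open>glue\<close> agrees with the given function;
  hence Laplacians add at shared corners.\<close>

lemma laplacian_glue:
  "laplacian (Suc m) (glue m l r t) (a, b) = laplacian m l (a, b) +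
     (if 2 ^ m \<le> a then laplacian m r (a - 2 ^ m, b) else 0) +
     (if 2 ^ m \<le> b then laplacian m t (a, b - 2 ^ m) else 0)"
proof -
  let ?g = "glue m l r t"
  have "(\<Sum>w\<in>sg_edges m `` {(a, b)}. ?g w - ?g (a, b)) = laplacian m l (a, b)"
    unfolding laplacian_def
    by (intro sum.cong refl) (use sg_nbrs_in[of _ m "(a, b)"] glue_on_copies(1) in auto)
  moreover have "(\<Sum>w\<in>sg_edges m `` {(a - 2 ^ m, b)}. ?g (shift (2 ^ m, 0) w) - ?g (a, b)) =
    laplacian m r (a - 2 ^ m, b)" if "2 ^ m \<le> a"
  proof -
    have "(a, b) = shift (2 ^ m, 0) (a - 2 ^ m, b)" using that by (simp add: shift_def)
    then show ?thesis
      unfolding laplacian_def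
      by (intro sum.cong refl) (use sg_nbrs_in[of _ m "(a - 2 ^ m, b)"] glue_on_copies(2) in metis)
  qed
  moreover have "(\<Sum>w\<in>sg_edges m `` {(a, b - 2 ^ m)}. ?g (shift (0, 2 ^ m) w) - ?g (a, b)) =
    laplacian m t (a, b - 2 ^ m)" if "2 ^ m \<le> b"
  proof -
    have "(a, b) = shift (0, 2 ^ m) (a, b - 2 ^ m)" using that by (simp add: shift_def)
    then show ?thesis
      unfolding laplacian_def
      by (intro sum.cong refl) (use sg_nbrs_in[of _ m "(a, b - 2 ^ m)"] glue_on_copies(3) in metis)
  qed
  ultimately show ?thesis
    unfolding laplacian_def[of "Suc m"] sum_sg_nbrs_Suc by simp
qed

end

lemma glue_nonneg:
  "\<lbrakk>\<And>v. 0 \<le> l v; \<And>v. 0 \<le> r v; \<And>v. 0 \<le> t v\<rbrakk> \<Longrightarrow> 0 \<le> glue m l r t v"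
  by (auto simp: glue_def split: prod.split)

lemma glue_neq_0:
  "glue m l r t (a, b) \<noteq> 0 \<Longrightarrow>
     a + b \<le> 2 ^ m \<and> l (a, b) \<noteq> 0 \<or> 2 ^ m \<le> a \<and> r (a - 2 ^ m, b) \<noteq> 0 \<or>
     2 ^ m \<le> b \<and> t (a, b - 2 ^ m) \<noteq> 0"
  by (auto simp: glue_def split: if_splits)


section \<open>A stabilizing function with Laplacian two\<close>

text \<open>
  The corners of the level \<open>k\<close> triangle carry the values \<open>5 ^ k * A\<close>, \<open>5 ^ k * B\<close>, \<open>5 ^ k * C\<close>. The
  values at the midpoints follow the harmonic 1/5-2/5 rule; the correction by \<open>- 1\<close> makes the
  Laplacian equal to two instead of zero.
\<close>

fun profile :: "nat \<Rightarrow> int \<Rightarrow> int \<Rightarrow> int \<Rightarrow> point \<Rightarrow> int" where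
  "profile 0 A B C =
     (\<lambda>v. if v = (0, 0) then A else if v = (1, 0) then B else if v = (0, 1) then C else 0)"
| "profile (Suc k) A B C =
     glue k (profile k (5 * A) (2 * A + 2 * B + C - 1) (2 * A + B + 2 * C - 1))
       (profile k (2 * A + 2 * B + C - 1) (5 * B) (A + 2 * B + 2 * C - 1))
       (profile k (2 * A + B + 2 * C - 1) (A + 2 * B + 2 * C - 1) (5 * C))"

lemma profile_corners:
  "profile k A B C (0, 0) = 5 ^ k * A"
  "profile k A B C (2 ^ k, 0) = 5 ^ k * B"
  "profile k A B C (0, 2 ^ k) = 5 ^ k * C"
  by (induction k arbitrary: A B C) (simp_all add: glue_def)

text \<open>Passing to the subtriangle at a corner multiplies its factor by three, for instance
  \<open>B + C - 2 * A - 1\<close> becomes \<open>3 * (B + C - 2 * A - 1)\<close>. At a midpoint the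
  two factors are opposite, for instance \<open>3 * (A - B)\<close> and \<open>3 * (B - A)\<close>,
  so only 1 + 1 remains.\<close>

lemma laplacian_profile:
  "v \<in> sg_verts k \<Longrightarrow> laplacian k (profile k A B C) v =
     (if v = (0, 0) then 3 ^ k * (B + C - 2 * A - 1) + 1
      else if v = (2 ^ k, 0) then 3 ^ k * (A + C - 2 * B - 1) + 1
      else if v = (0, 2 ^ k) then 3 ^ k * (A + B - 2 * C - 1) + 1
      else 2)"
proof (induction k arbitrary: v A B C)
  case 0
  have "sg_edges 0 `` {(0, 0)} = {(1, 0), (0, 1)}" "sg_edges 0 `` {(1, 0)} = {(0, 0), (0, 1)}"
    "sg_edges 0 `` {(0, 1)} = {(0, 0), (1, 0)}"
    by (simp_all add: sg_corners_def Image_singleton) blast+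
  moreover from 0 have "v = (0, 0) \<or> v = (1, 0) \<or> v = (0, 1)"
    by (simp add: sg_corners_def)
  ultimately show ?case
    by (elim disjE) (simp_all add: laplacian_def del: sg_edges.simps)
next
  case (Suc k)
  obtain a b where v: "v = (a, b)" by (cases v)
  define N :: nat where "N = 2 ^ k"
  have N: "2 ^ k = N" "0 < N" "2 ^ Suc k = 2 * N" by (simp_all add: N_def)
  define l where "l = profile k (5 * A) (2 * A + 2 * B + C - 1) (2 * A + B + 2 * C - 1)"
  define r where "r = profile k (2 * A + 2 * B + C - 1) (5 * B) (A + 2 * B + 2 * C - 1)"
  define t where "t = profile k (2 * A + B + 2 * C - 1) (A + 2 * B + 2 * C - 1) (5 * C)"
  note lap = Suc.IH[of _ "5 * A" "2 * A + 2 * B + C - 1" "2 * A + B + 2 * C - 1", folded l_def, unfolded N]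
    Suc.IH[of _ "2 * A + 2 * B + C - 1" "5 * B" "A + 2 * B + 2 * C - 1", folded r_def, unfolded N]
    Suc.IH[of _ "2 * A + B + 2 * C - 1" "A + 2 * B + 2 * C - 1" "5 * C", folded t_def, unfolded N]
  note corners = sg_corners_in[of k, unfolded N]
  have "laplacian (Suc k) (profile (Suc k) A B C) (a, b) = laplacian k l (a, b) +
     (if N \<le> a then laplacian k r (a - N, b) else 0) +
     (if N \<le> b then laplacian k t (a, b - N) else 0)"
    unfolding profile.simps l_def[symmetric] r_def[symmetric] t_def[symmetric] N(1)[symmetric]
    by (rule laplacian_glue) (simp_all add: l_def r_def t_def profile_corners)
  also from Suc.prems[unfolded v]
  have "\<dots> = (if (a, b) = (0, 0) then 3 ^ Suc k * (B + C - 2 * A - 1) + 1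
      else if (a, b) = (2 * N, 0) then 3 ^ Suc k * (A + C - 2 * B - 1) + 1
      else if (a, b) = (0, 2 * N) then 3 ^ Suc k * (A + B - 2 * C - 1) + 1
      else 2)"
  proof (cases rule: sg_Suc_cases[where m = k, unfolded N, consumes 1, case_names left right top left_right left_top right_top])
    case left
    then show ?thesis using lap(1)[OF left(1)] by (simp add: algebra_simps)
  next
    case (right a')
    then show ?thesis
      using lap(2)[OF right(2)] laplacian_outside[OF right(5)] by (auto simp: algebra_simps)
  next
    case (top b')
    then show ?thesis
      using lap(3)[OF top(2)] laplacian_outside[OF top(5)] by (auto simp: algebra_simps)
  next
    case left_right
    then show ?thesis
      using lap(1)[OF corners(2)] lap(2)[OF corners(1)] N(2) by (simp add: algebra_simps)
  next
    case left_top
    then show ?thesis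
      using lap(1)[OF corners(3)] lap(3)[OF corners(1)] N(2) by (simp add: algebra_simps)
  next
    case right_top
    moreover have "(N, N) \<notin> sg_verts k" using sg_verts_le[of "(N, N)" k] N by auto
    ultimately show ?thesis
      using lap(2)[OF corners(3)] lap(3)[OF corners(2)] laplacian_outside[of "(N, N)" k l] N(2)
      by (simp add: algebra_simps)
  qed
  finally show ?case unfolding v N .
qed

text \<open>Integrality absorbs the \<open>- 1\<close>: if \<open>A + B + C\<close> is at least 1,
  the midpoint values are nonnegative, and each subtriangle again has a positive corner sum, for
  instance \<open>9 * A + 3 * B + 3 * C - 2\<close>.\<close>

lemma profile_nonneg:
  "\<lbrakk>0 \<le> A; 0 \<le> B; 0 \<le> C; 0 < A + B + C\<rbrakk> \<Longrightarrow> 0 \<le> profile k A B C v"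
proof (induction k arbitrary: A B C v)
  case (Suc k)
  show ?case unfolding profile.simps
    by (intro glue_nonneg Suc.IH) (use Suc.prems in linarith)+
qed auto

lemma profile_support: "profile k A B C (a, b) \<noteq> 0 \<Longrightarrow> a + b \<le> 2 ^ k"
proof (induction k arbitrary: A B C a b)
  case (Suc k)
  from glue_neq_0[OF Suc.prems[unfolded profile.simps]] show ?case
    by (auto dest!: Suc.IH)
qed (auto split: if_splits)

section \<open>Point sources at a corner, extended by zero to higher levels\<close>

lemma source_at_left_corner:
  assumes "k \<le> M"
  shows "\<exists>f. (\<forall>v. 0 \<le> f v) \<and> f (0, 0) = 5 ^ k \<and> f (2 ^ M, 0) = 0 \<and> f (0, 2 ^ M) = 0 \<and>
    laplacian M f (0, 0) = 1 - 3 ^ Suc k \<and>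
    (\<forall>v. v \<noteq> (0, 0) \<longrightarrow> laplacian M f v \<le> (if v \<in> sg_corners M then 1 else 2)) \<and>
    (\<forall>a b. f (a, b) \<noteq> 0 \<longrightarrow> a + b \<le> 2 ^ k)"
  using assms
proof (induction M rule: dec_induct)
  case base
  \<comment> \<open>With these values the factor is -3 at the source and 0 at the other two corners,
    whose Laplacian is therefore exactly 1. This is below the corner degree 2.\<close>
  let ?f = "profile k 1 0 0"
  have "laplacian k ?f v \<le> (if v \<in> sg_corners k then 1 else 2)" if "v \<noteq> (0, 0)" for v
    using that laplacian_profile[of v k 1 0 0] laplacian_outside[of v k ?f]
    by (cases "v \<in> sg_verts k") (auto simp: sg_corners_def)
  then show ?case
    using laplacian_profile[OF sg_corners_in(1), of k 1 0 0]
    by (intro exI[of _ ?f]) (auto simp: profile_corners intro: profile_nonneg dest: profile_support)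
next
  case (step M)
  then obtain f where f: "\<And>v. 0 \<le> f v" "f (0, 0) = 5 ^ k" "f (2 ^ M, 0) = 0" "f (0, 2 ^ M) = 0"
    "laplacian M f (0, 0) = 1 - 3 ^ Suc k"
    "\<And>v. v \<noteq> (0, 0) \<Longrightarrow> laplacian M f v \<le> (if v \<in> sg_corners M then 1 else 2)"
    "\<And>a b. f (a, b) \<noteq> 0 \<Longrightarrow> a + b \<le> 2 ^ k" by blast
  \<comment> \<open>The two vanishing corner values make extension by zero compatible, so the
    Laplacian does not change.\<close>
  let ?g = "glue M f (\<lambda>_. 0) (\<lambda>_. 0)"
  have lap: "laplacian (Suc M) ?g v = laplacian M f v" for v
    using laplacian_glue[of f M "\<lambda>_. 0" "\<lambda>_. 0" "fst v" "snd v"] f(3,4)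
    by (simp add: laplacian_zero)
  have "laplacian M f v \<le> (if v \<in> sg_corners (Suc M) then 1 else 2)" if v: "v \<noteq> (0, 0)" for v
  proof (cases "v \<in> sg_corners (Suc M)")
    case True
    then have "v \<notin> sg_verts M" using v sg_verts_le[of v M] by (auto simp: sg_corners_def)
    then show ?thesis by (simp add: laplacian_outside)
  next
    case False
    then show ?thesis using f(6)[OF v] by (simp split: if_splits)
  qed
  moreover have "0 \<le> ?g v" for v using f(1) by (simp add: glue_nonneg)
  moreover have "a + b \<le> 2 ^ k" if "?g (a, b) \<noteq> 0" for a b
    using glue_neq_0[OF that] f(7) by auto
  moreover have "?g (0, 0) = 5 ^ k" "?g (2 ^ Suc M, 0) = 0" "?g (0, 2 ^ Suc M) = 0"
    using f(2) by (simp_all add: glue_def)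
  ultimately show ?case
    using f(5) by (intro exI[of _ ?g]) (simp only: lap, blast)
qed

lemma source_at_right_corner:
  assumes "k \<le> M"
  shows "\<exists>f. (\<forall>v. 0 \<le> f v) \<and> f (2 ^ M, 0) = 5 ^ k \<and> f (0, 0) = 0 \<and> f (0, 2 ^ M) = 0 \<and>
    laplacian M f (2 ^ M, 0) = 1 - 3 ^ Suc k \<and>
    (\<forall>v. v \<noteq> (2 ^ M, 0) \<longrightarrow> laplacian M f v \<le> (if v \<in> sg_corners M then 1 else 2)) \<and>
    (\<forall>a b. f (a, b) \<noteq> 0 \<longrightarrow> 2 ^ M \<le> a + 2 ^ k \<and> b \<le> 2 ^ k)"
  using assms
proof (induction M rule: dec_induct)
  case base
  let ?f = "profile k 0 1 0"
  have "laplacian k ?f v \<le> (if v \<in> sg_corners k then 1 else 2)" if "v \<noteq> (2 ^ k, 0)" for v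
    using that laplacian_profile[of v k 0 1 0] laplacian_outside[of v k ?f]
    by (cases "v \<in> sg_verts k") (auto simp: sg_corners_def)
  moreover have "b \<le> 2 ^ k" if "?f (a, b) \<noteq> 0" for a b
    using profile_support[OF that] by simp
  ultimately show ?case
    using laplacian_profile[OF sg_corners_in(2), of k 0 1 0]
    by (intro exI[of _ ?f]) (auto simp: profile_corners intro: profile_nonneg)
next
  case (step M)
  then obtain f where f: "\<And>v. 0 \<le> f v" "f (2 ^ M, 0) = 5 ^ k" "f (0, 0) = 0" "f (0, 2 ^ M) = 0"
    "laplacian M f (2 ^ M, 0) = 1 - 3 ^ Suc k"
    "\<And>v. v \<noteq> (2 ^ M, 0) \<Longrightarrow> laplacian M f v \<le> (if v \<in> sg_corners M then 1 else 2)"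
    "\<And>a b. f (a, b) \<noteq> 0 \<Longrightarrow> 2 ^ M \<le> a + 2 ^ k \<and> b \<le> 2 ^ k" by blast
  \<comment> \<open>Now the old graph becomes the right copy, so that the source stays at the right
    corner.\<close>
  let ?g = "glue M (\<lambda>_. 0) f (\<lambda>_. 0)"
  have lap: "laplacian (Suc M) ?g (a, b) = (if 2 ^ M \<le> a then laplacian M f (a - 2 ^ M, b) else 0)" for a b
    using laplacian_glue[of "\<lambda>_. 0" M f "\<lambda>_. 0" a b] f(3,4)
    by (simp add: laplacian_zero)
  have "laplacian (Suc M) ?g v \<le> (if v \<in> sg_corners (Suc M) then 1 else 2)"
    if v: "v \<noteq> (2 ^ Suc M, 0)" for v
  proof -
    obtain a b where ab: "v = (a, b)" by (cases v)
    show ?thesis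
    proof (cases "2 ^ M \<le> a")
      case True
      then have "v \<notin> sg_corners (Suc M)" using v ab by (auto simp: sg_corners_def)
      moreover have "(a - 2 ^ M, b) \<noteq> (2 ^ M, 0)" using v ab True by auto
      from f(6)[OF this] have "laplacian M f (a - 2 ^ M, b) \<le> 2" by (simp split: if_splits)
      ultimately show ?thesis using True by (simp add: ab lap)
    qed (simp add: ab lap)
  qed
  moreover have "0 \<le> ?g v" for v using f(1) by (simp add: glue_nonneg)
  moreover have "2 ^ Suc M \<le> a + 2 ^ k \<and> b \<le> 2 ^ k" if "?g (a, b) \<noteq> 0" for a b
    using glue_neq_0[OF that] f(7)[of "a - 2 ^ M" b] by auto
  moreover have "?g (2 ^ Suc M, 0) = 5 ^ k" "?g (0, 0) = 0" "?g (0, 2 ^ Suc M) = 0"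
    using f(2) by (simp_all add: glue_def)
  moreover have "laplacian (Suc M) ?g (2 ^ Suc M, 0) = 1 - 3 ^ Suc k"
    using f(5) by (simp add: lap)
  ultimately show ?case
    by (intro exI[of _ ?g]) blast
qed

text \<open>Two sources are glued at \<open>v0\<close>, with zero on the top copy. The Laplacian at
  \<open>v0\<close> is \<open>2 - 2 * 3 ^ Suc k\<close>, so the bound on \<open>n\<close> says
  precisely that at most 3 chips remain there. Elsewhere the Laplacian is at most 2, and at most 1
  at corners.\<close>

lemma stabilizing_function:
  assumes "k \<le> M" and n: "n \<le> 2 * 3 ^ Suc k + 1"
  shows "\<exists>f. (\<forall>v. 0 \<le> f v) \<and>
    (\<forall>v\<in>sg_verts (Suc M). int (sg_initial (Suc M) n v) + laplacian (Suc M) f v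
       < int (degree (sg_edges (Suc M)) v)) \<and>
    (\<forall>a b. f (a, b) \<noteq> 0 \<longrightarrow> 2 ^ M \<le> a + 2 ^ k \<and> a \<le> 2 ^ M + 2 ^ k \<and> b \<le> 2 ^ k)"
proof -
  obtain l where l: "\<And>v. 0 \<le> l v" "l (2 ^ M, 0) = 5 ^ k" "l (0, 2 ^ M) = 0"
    "laplacian M l (2 ^ M, 0) = 1 - 3 ^ Suc k"
    "\<And>v. v \<noteq> (2 ^ M, 0) \<Longrightarrow> laplacian M l v \<le> (if v \<in> sg_corners M then 1 else 2)"
    "\<And>a b. l (a, b) \<noteq> 0 \<Longrightarrow> 2 ^ M \<le> a + 2 ^ k \<and> b \<le> 2 ^ k"
    using source_at_right_corner[OF assms(1)] by blast
  obtain r where r: "\<And>v. 0 \<le> r v" "r (0, 0) = 5 ^ k" "r (0, 2 ^ M) = 0"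
    "laplacian M r (0, 0) = 1 - 3 ^ Suc k"
    "\<And>v. v \<noteq> (0, 0) \<Longrightarrow> laplacian M r v \<le> (if v \<in> sg_corners M then 1 else 2)"
    "\<And>a b. r (a, b) \<noteq> 0 \<Longrightarrow> a + b \<le> 2 ^ k"
    using source_at_left_corner[OF assms(1)] by blast
  let ?g = "glue M l r (\<lambda>_. 0)"
  define N :: nat where "N = 2 ^ M"
  have N: "2 ^ M = N" "0 < N" by (simp_all add: N_def)
  have corners: "sg_corners M = {(0, 0), (N, 0), (0, N)}"
    "sg_corners (Suc M) = {(0, 0), (2 * N, 0), (0, 2 * N)}"
    by (simp_all add: sg_corners_def N_def)
  have lap: "laplacian (Suc M) ?g (a, b) =
    laplacian M l (a, b) + (if N \<le> a then laplacian M r (a - N, b) else 0)" for a b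
    using laplacian_glue[of l M r "\<lambda>_. 0" a b] l(2,3) r(2,3)
    by (simp add: laplacian_zero N)
  have "int (sg_initial (Suc M) n v) + laplacian (Suc M) ?g v < int (degree (sg_edges (Suc M)) v)"
    if v: "v \<in> sg_verts (Suc M)" for v
  proof -
    obtain a b where ab: "v = (a, b)" by (cases v)
    have origin: "sg_origin (Suc M) = (N, 0)" by (simp add: sg_origin_def N)
    show ?thesis
    proof (cases "v = (N, 0)")
      case True
      have "int (sg_initial (Suc M) n v) = int n" by (simp add: True sg_initial_def origin)
      moreover have "laplacian (Suc M) ?g v = 2 - 2 * 3 ^ Suc k"
        using l(4) r(4) by (simp add: True lap N)
      moreover have "int n \<le> 2 * 3 ^ Suc k + 1" using of_nat_mono[OF n, where 'a = int] by simp
      moreover have "degree (sg_edges (Suc M)) v = 4"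
        using sg_degree[OF v] N(2) by (simp add: True corners)
      ultimately show ?thesis by linarith
    next
      case False
      from v[unfolded ab]
      have "laplacian (Suc M) ?g (a, b) \<le> (if (a, b) \<in> sg_corners (Suc M) then 1 else 2)"
      proof (cases rule: sg_Suc_cases[where m = M, unfolded N, consumes 1, case_names left right top left_right left_top right_top])
        case left
        then show ?thesis using l(5)[of "(a, b)"] by (simp add: lap corners N split: if_splits)
      next
        case (right a')
        then have "a' \<noteq> 0 \<or> b \<noteq> 0" by auto
        with right show ?thesis using r(5)[of "(a', b)"] laplacian_outside[OF right(5)]
          by (auto simp: lap corners N split: if_splits)
      next
        case (top b')
        then show ?thesis using laplacian_outside[OF top(5)] by (simp add: lap)
      next
        case left_right
        then show ?thesis using False ab by simp
      next
        case left_top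
        moreover from this N(2) have "\<not> N \<le> a" by simp
        ultimately show ?thesis using l(5)[of "(0, N)"] N by (simp add: lap corners)
      next
        case right_top
        moreover have "(N, N) \<notin> sg_verts M" using sg_verts_le[of "(N, N)" M] N by auto
        ultimately show ?thesis
          using r(5)[of "(0, N)"] laplacian_outside[of "(N, N)" M l] N(2) by (simp add: lap corners)
      qed
      moreover have "sg_initial (Suc M) n v = 0" using False by (simp add: sg_initial_def origin)
      ultimately show ?thesis using sg_degree[OF v] by (simp add: ab split: if_splits)
    qed
  qed
  moreover have "0 \<le> ?g v" for v using l(1) r(1) by (simp add: glue_nonneg)
  moreover have "2 ^ M \<le> a + 2 ^ k \<and> a \<le> 2 ^ M + 2 ^ k \<and> b \<le> 2 ^ k" if "?g (a, b) \<noteq> 0" for a b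
    using glue_neq_0[OF that] l(6)[of a b] r(6)[of "a - 2 ^ M" b] by auto
  ultimately show ?thesis by blast
qed


section \<open>The radius\<close>

text \<open>By least action only vertices in the support of \<open>f\<close> topple. Occupied
  vertices are at most one step further out, hence the \<open>+ 1\<close> in each bound.\<close>

lemma sg_confined:
  assumes "k \<le> M" "n \<le> 2 * 3 ^ Suc k + 1"
  shows "\<exists>vs. sg_stabilizing (Suc M) n vs"
    and "\<lbrakk>sg_stabilizing (Suc M) n vs; v \<in> sg_occupied (Suc M) n vs\<rbrakk> \<Longrightarrow>
      2 ^ M \<le> fst v + 2 ^ k + 1 \<and> fst v \<le> 2 ^ M + 2 ^ k + 1 \<and> snd v \<le> 2 ^ k + 1"
proof -
  obtain f where f: "\<And>v. 0 \<le> f v"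
    "\<And>v. v \<in> sg_verts (Suc M) \<Longrightarrow> int (sg_initial (Suc M) n v) + laplacian (Suc M) f v
       < int (degree (sg_edges (Suc M)) v)"
    "\<And>a b. f (a, b) \<noteq> 0 \<Longrightarrow> 2 ^ M \<le> a + 2 ^ k \<and> a \<le> 2 ^ M + 2 ^ k \<and> b \<le> 2 ^ k"
    using stabilizing_function[OF assms] by blast
  note f_stabilizes = f(2)[unfolded laplacian_def]
  show "\<exists>vs. sg_stabilizing (Suc M) n vs"
    unfolding sg_stabilizing_def using f(1) f_stabilizes by (rule sg.stabilizing_exists)
  assume vs: "sg_stabilizing (Suc M) n vs" and v: "v \<in> sg_occupied (Suc M) n vs"
  have legal: "legal (sg_verts (Suc M)) (sg_edges (Suc M)) (sg_initial (Suc M) n) vs"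
    using vs by (simp add: sg_stabilizing_def stabilizing_def del: sg_verts.simps sg_edges.simps)
  from sg.occupied_origin[OF v[unfolded sg_occupied_def]]
  show "2 ^ M \<le> fst v + 2 ^ k + 1 \<and> fst v \<le> 2 ^ M + 2 ^ k + 1 \<and> snd v \<le> 2 ^ k + 1"
  proof
    assume "1 \<le> sg_initial (Suc M) n v"
    then have "v = (2 ^ M, 0)" by (auto simp: sg_initial_def sg_origin_def split: if_splits)
    then show ?thesis by simp
  next
    assume "\<exists>w\<in>set vs. (w, v) \<in> sg_edges (Suc M)"
    then obtain w where w: "w \<in> set vs" "(w, v) \<in> sg_edges (Suc M)" by blast
    have "0 < count_list vs w" using w(1) by (simp add: count_list_0_iff neq0_conv[symmetric])
    then have "f w \<noteq> 0" using sg.least_action[OF legal f(1) f_stabilizes, of w] by linarith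
    then have "2 ^ M \<le> fst w + 2 ^ k \<and> fst w \<le> 2 ^ M + 2 ^ k \<and> snd w \<le> 2 ^ k"
      using f(3)[of "fst w" "snd w"] by simp
    moreover have "(v, w) \<in> sg_edges (Suc M)" using w(2) sym_sg_edges by (rule symD[rotated])
    ultimately show ?thesis
      using sg_edges_lipschitz[OF w(2)] sg_edges_lipschitz[of v w "Suc M"] by linarith
  qed
qed

section \<open>Existence of a sufficient level\<close>

lemma power_bracket:
  assumes "1 \<le> (n::nat)" "2 \<le> b"
  obtains k where "b ^ k \<le> n" "n < b ^ Suc k"
  using ex_power_ivl1[OF assms(2,1)] by auto

lemma sg_large_enough_eventually:
  assumes "1 \<le> n"
  shows "\<exists>M. \<forall>m\<ge>M. sg_large_enough m n"
proof -
  obtain k where k: "3 ^ k \<le> n" "n < 3 ^ Suc k"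
    using power_bracket[OF assms, of 3] by auto
  have "sg_large_enough m n" if m: "k + 3 \<le> m" for m
  proof -
    from m obtain M where M: "m = Suc M" "k + 2 \<le> M" by (cases m) auto
    have le: "k \<le> M" "n \<le> 2 * 3 ^ Suc k + 1" using k M by auto
    have "(2::nat) ^ (k + 2) \<le> 2 ^ M" using M(2) by (rule power_increasing) simp
    \<comment> \<open>The confining box then stays below height \<open>2 ^ M\<close>, where the top
      copy starts, and away from both bottom corners.\<close>
    then have big: "2 ^ k + 1 < (2::nat) ^ M"
      using one_le_power[of "2::nat" k] unfolding power_add power2_eq_square by linarith
    have "v \<notin> sg_top_copy m \<union> sg_corners m"
      if "sg_stabilizing m n vs" "v \<in> sg_occupied m n vs" for v vs
      using sg_confined(2)[OF le that[unfolded M(1)]] big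
      by (auto simp: sg_top_copy_def sg_corners_def shift_def M(1))
    then show ?thesis
      using sg_confined(1)[OF le] by (auto simp: sg_large_enough_def M(1) simp del: sg_verts.simps)
  qed
  then show ?thesis by blast
qed

section \<open>Radius bounds for one stabilization\<close>

locale sg_process =
  fixes M n :: nat and vs :: "point list"
  assumes n_pos: "1 \<le> n"
    and large: "sg_large_enough (Suc M) n"
    and stabilizing: "sg_stabilizing (Suc M) n vs"
begin

abbreviation occ :: "point set" where
  "occ \<equiv> sg_occupied (Suc M) n vs"

abbreviation dist_origin :: "point \<Rightarrow> nat" where
  "dist_origin \<equiv> graph_dist (sg_edges (Suc M)) (2 ^ M, 0)"

lemma occ_in: "occ \<subseteq> sg_verts (Suc M)"
  by (auto simp: sg_occupied_def occupied_def simp del: sg_verts.simps)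

lemma finite_occ: "finite occ"
  using occ_in finite_sg_verts by (rule finite_subset)

lemma origin_occ: "(2 ^ M, 0) \<in> occ"
proof -
  have "(2 ^ M, 0) \<in> sg_verts (Suc M)" using sg_corners_in(2)[of M] by simp
  then show ?thesis
    using n_pos unfolding sg_occupied_def occupied_def
    by (auto intro!: exI[of _ 0] simp: sg_initial_def sg_origin_def simp del: sg_verts.simps)
qed

lemma radius_eq: "sg_radius (Suc M) n vs = Max (dist_origin ` occ)"
  by (simp add: sg_radius_def sg_origin_def)

text \<open>Once the top copy is excluded, \<open>v0\<close> is a corner of the copy containing
  \<open>v\<close>, so the corner paths apply.\<close>

lemma occ_cases:
  assumes "v \<in> occ"
  obtains (left) "v \<in> sg_verts M" "((2 ^ M, 0), v) \<in> sg_edges (Suc M) ^^ (2 ^ M - fst v)"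
    | (right) w where "v = shift (2 ^ M, 0) w" "w \<in> sg_verts M"
        "((2 ^ M, 0), v) \<in> sg_edges (Suc M) ^^ (fst w + snd w)"
proof -
  have "v \<notin> sg_top_copy (Suc M)"
    using large stabilizing assms unfolding sg_large_enough_def by blast
  then consider "v \<in> sg_verts M" | w where "v = shift (2 ^ M, 0) w" "w \<in> sg_verts M"
    using assms occ_in by (auto simp: sg_top_copy_def)
  then show ?thesis
  proof cases
    case 1
    then show ?thesis using sg_path_Suc(1)[OF sg_path_from_right[OF 1]] by (rule left)
  next
    case 2
    have "((2 ^ M, 0), v) \<in> sg_edges (Suc M) ^^ (fst w + snd w)"
      using sg_path_Suc(2)[OF sg_path_from_left[OF 2(2)]] unfolding 2(1) by (simp add: shift_def)
    with 2 show ?thesis by (rule right)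
  qed
qed

lemma radius_le:
  assumes "n \<le> 2 * 3 ^ Suc k + 1"
  shows "sg_radius (Suc M) n vs \<le> 4 * 2 ^ k"
proof -
  have dist_le: "dist_origin v \<le> j" if "((2 ^ M, 0), v) \<in> sg_edges (Suc M) ^^ j" for v j
    unfolding graph_dist_def using that by (rule Least_le)
  have "dist_origin v \<le> 4 * 2 ^ k" if v: "v \<in> occ" for v
  \<comment> \<open>The box gives at most \<open>2 * (2 ^ k + 1)\<close> steps, which is at most
    \<open>4 * 2 ^ k\<close>. If \<open>M < k\<close>, the box lemma does not apply, but each bottom
    copy reaches only \<open>2 ^ M\<close> steps from \<open>v0\<close>.\<close>
  proof (cases "k \<le> M")
    case True
    note box = sg_confined(2)[OF True assms stabilizing v]
    have "(1::nat) \<le> 2 ^ k" by simp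
    from v show ?thesis
    proof (cases rule: occ_cases)
      case left
      with dist_le[OF left(2)] box \<open>1 \<le> 2 ^ k\<close> show ?thesis by linarith
    next
      case (right w)
      then have "fst v = fst w + 2 ^ M" "snd v = snd w" by (simp_all add: shift_def)
      with dist_le[OF right(3)] box \<open>1 \<le> 2 ^ k\<close> show ?thesis by linarith
    qed
  next
    case False
    then have M: "(2::nat) ^ M \<le> 2 ^ k" by (intro power_increasing) auto
    from v show ?thesis
    proof (cases rule: occ_cases)
      case left
      with dist_le[OF left(2)] M show ?thesis by linarith
    next
      case (right w)
      with dist_le[OF right(3)] sg_verts_le[OF right(2)] M show ?thesis by linarith
    qed
  qed
  then show ?thesis
    unfolding radius_eq using finite_occ origin_occ by (subst Max_le_iff) auto
qed

text \<open>The occupied set lies in a ball made of two corner neighbourhoods, with at most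
  \<open>2 * 3 ^ Suc k\<close> vertices in all. Three chips on each give at most
  \<open>18 * 3 ^ k\<close> chips, rounded up to \<open>27 * 3 ^ k\<close>.\<close>

lemma le_of_radius_less:
  assumes "sg_radius (Suc M) n vs < 2 ^ k"
  shows "n \<le> 3 ^ (k + 3)"
proof -
  let ?L = "{v \<in> sg_verts M. 2 ^ M < fst v + 2 ^ k}"
  let ?R = "{w \<in> sg_verts M. fst w + snd w < 2 ^ k}"
  have "v \<in> ?L \<union> shift (2 ^ M, 0) ` ?R" if v: "v \<in> occ" for v
  proof -
    have "dist_origin v \<le> sg_radius (Suc M) n vs"
      unfolding radius_eq using finite_occ v by (intro Max_ge) auto
    then have less: "dist_origin v < 2 ^ k" using assms by linarith
    \<comment> \<open>The \<open>LEAST\<close> in \<open>graph_dist\<close> is attained only because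
      some path exists.\<close>
    have "\<exists>j. ((2 ^ M, 0), v) \<in> sg_edges (Suc M) ^^ j"
      using v by (cases rule: occ_cases) blast+
    then have "((2 ^ M, 0), v) \<in> sg_edges (Suc M) ^^ dist_origin v"
      unfolding graph_dist_def by (rule LeastI_ex)
    from sg_path_lipschitz[OF this]
    have "2 ^ M \<le> fst v + dist_origin v" "fst v + snd v \<le> 2 ^ M + dist_origin v" by simp_all
    note close = this less
    from v show ?thesis
    proof (cases rule: occ_cases)
      case left
      then show ?thesis using close by simp
    next
      case (right w)
      then have "fst w + snd w < 2 ^ k" using close by (simp add: shift_def)
      then show ?thesis using right by blast
    qed
  qed
  then have "card occ \<le> card (?L \<union> shift (2 ^ M, 0) ` ?R)"
    by (intro card_mono) (auto simp: finite_sg_verts)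
  also have "\<dots> \<le> card ?L + card (shift (2 ^ M, 0) ` ?R)" by (rule card_Un_le)
  also have "\<dots> \<le> 3 ^ Suc k + 3 ^ Suc k"
    using card_sg_right_part card_sg_left_part card_image_le[of ?R "shift (2 ^ M, 0)"] finite_sg_verts
    by (intro add_mono) (auto intro: order_trans)
  finally have card: "card occ \<le> 2 * 3 ^ Suc k" by simp
  have "n = (\<Sum>v\<in>sg_verts (Suc M). sg_initial (Suc M) n v)"
    using origin_occ occ_in finite_sg_verts[of "Suc M"]
    by (simp add: sg_initial_def sg_origin_def subset_iff del: sg_verts.simps)
  also have "\<dots> \<le> 3 * card occ"
    unfolding sg_occupied_def
    by (rule sg.sum_le_card_occupied[OF stabilizing[unfolded sg_stabilizing_def]]) (simp add: sg_degree del: sg_verts.simps sg_edges.simps)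
  finally show ?thesis using card by (simp add: power_add)
qed

end

section \<open>Passage from powers of 3 and 2 to the exponent 1 / D_f\<close>

lemma power_3_powr: "(3 ^ k) powr (1 / (ln 3 / ln 2)) = (2 ^ k :: real)"
proof -
  have "(3 ^ k) powr (1 / (ln 3 / ln 2)) = exp (real k * ln 2)"
    by (simp add: powr_def ln_realpow)
  also have "\<dots> = 2 ^ k" by (simp add: exp_of_nat_mult)
  finally show ?thesis .
qed

text \<open>Level and toppling order are arbitrary for each \<open>n\<close>, so the asymptotics
  cannot depend on them; the first conjunct ensures that admissible choices exist.\<close>

theorem theorem1:
  "(\<forall>n\<ge>1. \<exists>M. \<forall>m\<ge>M. sg_large_enough m n) \<and>
   (\<forall>(m :: nat \<Rightarrow> nat) (vs :: nat \<Rightarrow> point list).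
      (\<forall>n\<ge>1. sg_large_enough (m n) n \<and> sg_stabilizing (m n) n (vs n)) \<longrightarrow>
      (\<lambda>n. real (sg_radius (m n) n (vs n))) \<in> \<Theta>(\<lambda>n. real n powr (1 / (ln 3 / ln 2))))"
proof (intro conjI allI impI)
  fix n :: nat assume "1 \<le> n"
  then show "\<exists>M. \<forall>m\<ge>M. sg_large_enough m n" by (rule sg_large_enough_eventually)
next
  fix m :: "nat \<Rightarrow> nat" and vs :: "nat \<Rightarrow> point list"
  assume H: "\<forall>n\<ge>1. sg_large_enough (m n) n \<and> sg_stabilizing (m n) n (vs n)"
  let ?\<alpha> = "1 / (ln 3 / ln 2) :: real"
  have process: "sg_process (m n - 1) n (vs n)" "Suc (m n - 1) = m n" if "1 \<le> n" for n
  proof -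
    have "sg_large_enough (m n) n" "sg_stabilizing (m n) n (vs n)" using H that by auto
    moreover from this show "Suc (m n - 1) = m n" by (simp add: sg_large_enough_def)
    ultimately show "sg_process (m n - 1) n (vs n)" using that by (simp add: sg_process_def)
  qed
  define r where "r n = sg_radius (m n) n (vs n)" for n
  have upper: "real (r n) \<le> 4 * real n powr ?\<alpha>" if n: "1 \<le> n" for n
  proof -
    obtain k where k: "3 ^ k \<le> n" "n < 3 ^ Suc k"
      using power_bracket[OF n, of 3] by auto
    have "r n \<le> 4 * 2 ^ k"
      using sg_process.radius_le[OF process(1)[OF n], of k, unfolded process(2)[OF n]] k
      by (simp add: r_def)
    then have "real (r n) \<le> 4 * 2 ^ k"
      using of_nat_mono[of "r n" "4 * 2 ^ k", where 'a = real] by simp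
    also have "\<dots> = 4 * (3 ^ k) powr ?\<alpha>" by (simp only: power_3_powr)
    also have "\<dots> \<le> 4 * real n powr ?\<alpha>"
      using of_nat_mono[OF k(1), where 'a = real] by (intro mult_left_mono powr_mono2) auto
    finally show ?thesis .
  qed
  have few_chips: "n \<le> 3 ^ (k + 3)" if "1 \<le> n" "r n < 2 ^ k" for n k
    using sg_process.le_of_radius_less[OF process(1)[OF that(1)], of k, unfolded process(2)[OF that(1)]] that(2)
    by (simp only: r_def)
  have powr_le: "real n powr ?\<alpha> \<le> 2 ^ (k + 3)" if "1 \<le> n" "r n < 2 ^ k" for n k
  proof -
    have "real n \<le> 3 ^ (k + 3)"
      using of_nat_mono[OF few_chips[OF that], where 'a = real] by simp
    then have "real n powr ?\<alpha> \<le> (3 ^ (k + 3)) powr ?\<alpha>" by (intro powr_mono2) auto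
    then show ?thesis by (simp only: power_3_powr)
  qed
  \<comment> \<open>A zero radius, being below \<open>2 ^ 0\<close>, would force
    \<open>n \<le> 27\<close>; from 28 on the radius lies between consecutive powers of 2. The
    factor 16 is one doubling from that bracket times \<open>2 ^ 3\<close> from
    \<open>powr_le\<close>.\<close>
  have lower: "real n powr ?\<alpha> \<le> 16 * real (r n)" if n: "28 \<le> n" for n
  proof -
    have "1 \<le> r n"
    proof (rule ccontr)
      assume "\<not> 1 \<le> r n"
      then have "n \<le> 3 ^ (0 + 3)" using n by (intro few_chips) auto
      with n show False by simp
    qed
    then obtain k where k: "2 ^ k \<le> r n" "r n < 2 ^ Suc k"
      using power_bracket[of "r n" 2] by auto
    have "real n powr ?\<alpha> \<le> 2 ^ (Suc k + 3)" using n k(2) by (intro powr_le) auto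
    also have "\<dots> = 16 * 2 ^ k" by (simp add: power_add)
    also have "\<dots> \<le> 16 * real (r n)" using of_nat_mono[OF k(1), where 'a = real] by simp
    finally show ?thesis .
  qed
  have "(\<lambda>n. real (r n)) \<in> \<Theta>(\<lambda>n. real n powr ?\<alpha>)"
  proof (rule bigthetaI)
    show "(\<lambda>n. real (r n)) \<in> O(\<lambda>n. real n powr ?\<alpha>)"
      using upper by (intro bigoI[of _ 4] eventually_sequentiallyI[of 1]) auto
    show "(\<lambda>n. real (r n)) \<in> \<Omega>(\<lambda>n. real n powr ?\<alpha>)"
      using lower by (intro landau_omega.bigI[of "1 / 16"] eventually_sequentiallyI[of 28]) (auto simp: mult.commute)
  qed
  then show "(\<lambda>n. real (sg_radius (m n) n (vs n))) \<in> \<Theta>(\<lambda>n. real n powr ?\<alpha>)"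
    by (simp only: r_def)
qed

end
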